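(* For every positive integer $N$, \[ \sum_{\substack{\pi\in\mathcal{U}\\ |\pi|=N}} (-1)^{s(\pi)+1} \;=\; \sum_{\substack{\pi\in\mathcal{U}^*\\ |\pi|=N}} t(\pi). \] Equivalently, as formal power series in $q$: $\sum_{\pi\in\mathcal{U}} (-1)^{s(\pi)+1} q^{|\pi|} = \sum_{\pi\in\mathcal{U}^*} t(\pi) q^{|\pi|}$.
   Context: A partition is a finite non-increasing sequence of positive integers (its parts); $|\pi|$ is the sum of its parts and $s(\pi)$ its smallest part. For a positive integer $i$, $f_i=f_i(\pi)$ denotes the number of times $i$ occurs as a part of $\pi$ (possibly $0$). $\mathcal{U}$ is the set of all non-empty partitions, and $\mathcal{U}^*\subseteq\mathcal{U}$ is the subset of partitions with $f_1(\pi)$ odd. For a partition $\pi$, $t(\pi)$ is the non-negative integer such that $f_i(\pi)$ is odd for all $1\le i\le t(\pi)$ and $f_{t(\pi)+1}(\pi)$ is even (possibly zero). *)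

theory Defs
  imports
    "HOL-Analysis.Infinite_Sum"
    "HOL-Computational_Algebra.Formal_Power_Series"
begin

definition is_partition :: "nat list \<Rightarrow> bool" where
  "is_partition p \<longleftrightarrow> sorted_wrt (\<ge>) p \<and> (\<forall>x\<in>set p. 0 < x)"

definition freq :: "nat list \<Rightarrow> nat \<Rightarrow> nat" where
  "freq p i = count_list p i"

text \<open>Only meaningful for non-empty partitions.\<close>

definition smallest_part :: "nat list \<Rightarrow> nat" where
  "smallest_part p = Min (set p)"

definition nonempty_partitions :: "nat list set" where
  "nonempty_partitions = {p. is_partition p \<and> p \<noteq> []}"

definition partitions_odd_ones :: "nat list set" where
  "partitions_odd_ones = {p \<in> nonempty_partitions. odd (freq p 1)}"

definition odd_run :: "nat list \<Rightarrow> nat" where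
  "odd_run p =
     (THE t. (\<forall>i. 1 \<le> i \<and> i \<le> t \<longrightarrow> odd (freq p i)) \<and> even (freq p (t + 1)))"

text \<open>The description in \<^const>\<open>odd_run\<close> does determine a number: a list has only finitely many
  entries.\<close>

lemma odd_run_ex1:
  "\<exists>!t. (\<forall>i. 1 \<le> i \<and> i \<le> t \<longrightarrow> odd (freq p i)) \<and> even (freq p (t + 1))"
proof -
  define P where "P = (\<lambda>t. even (freq p (t + 1)))"
  have "x \<le> sum_list p" if "x \<in> set p" for x
    using that by (simp add: member_le_sum_list)
  then have "sum_list p + 1 \<notin> set p"
    by fastforce
  then have "P (sum_list p)"
    by (simp add: P_def freq_def count_list_0_iff)
  then have least: "P (Least P)"
    by (rule LeastI)
  have below: "odd (freq p i)" if i: "1 \<le> i" "i \<le> Least P" for i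
  proof -
    have "\<not> P (i - 1)"
      using i by (intro not_less_Least) linarith
    with i(1) show ?thesis
      unfolding P_def by simp
  qed
  show ?thesis
  proof (rule ex1I[of _ "Least P"])
    show "(\<forall>i. 1 \<le> i \<and> i \<le> Least P \<longrightarrow> odd (freq p i)) \<and> even (freq p (Least P + 1))"
      using below least unfolding P_def by blast
  next
    fix t
    assume t: "(\<forall>i. 1 \<le> i \<and> i \<le> t \<longrightarrow> odd (freq p i)) \<and> even (freq p (t + 1))"
    then have "P t" unfolding P_def by blast
    then have "Least P \<le> t" by (rule Least_le)
    moreover have "\<not> Least P < t"
    proof
      assume "Least P < t"
      then have "odd (freq p (Least P + 1))" using t by (metis Suc_eq_plus1 Suc_leI le_add2)
      then show False using least unfolding P_def by blast
    qed
    ultimately show "t = Least P" by linarith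
  qed
qed

text \<open>The sums over the partitions of a fixed number are sums over finite sets.\<close>

lemma finite_partitions_of: "finite {p \<in> nonempty_partitions. sum_list p = N}"
proof (rule finite_subset)
  have "length p \<le> sum_list p" if "\<forall>x\<in>set p. 0 < x" for p :: "nat list"
    using that by (induction p) auto
  then show "{p \<in> nonempty_partitions. sum_list p = N}
      \<subseteq> {p. set p \<subseteq> {..N} \<and> length p \<le> N}"
    by (auto simp: nonempty_partitions_def is_partition_def member_le_sum_list)
  show "finite {p. set p \<subseteq> {..N} \<and> length p \<le> N}"
    by (rule finite_lists_length_le) simp
qed

end

(*
  Both sides are expanded over the generating function P of all partitions.  Let A_m be the signed
  generating function of the partitions whose smallest part s occurs at least m times, with sign
  (-1)^(s+1), and B_j the unsigned one of the partitions in which 1, ..., j all occur an odd number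
  of times.
  The left-hand side is A_1 and the right-hand side is B_1 + B_2 + ...  Since
    (1 + q^m) A_m = q^m (P + A_(m+1))   and   (1 + q^j) B_j = q^j B_(j-1),   B_0 = P,
  iterating the first recurrence gives P (A_1 - B_1 - ... - B_k) = B_k A_(k+1), and the right-hand
  side is divisible by q^(k+1).
*)
theory Submission
  imports Defs "HOL-Library.Multiset"
begin

section \<open>Generating functions of sets with a size and a weight\<close>

unbundle fps_syntax

text \<open>An infinite fibre contributes 0, the default value of \<open>sum\<close>, so finiteness
  is assumed only for unions and for \<open>has_sum\<close>.\<close>

definition gf :: "('a \<Rightarrow> nat) \<Rightarrow> ('a \<Rightarrow> int) \<Rightarrow> 'a set \<Rightarrow> int fps" where
  "gf sz w A = Abs_fps (\<lambda>n. \<Sum>x\<in>{x \<in> A. sz x = n}. w x)"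

lemma gf_nth: "gf sz w A $ n = (\<Sum>x\<in>{x \<in> A. sz x = n}. w x)"
  by (simp add: gf_def)

lemma gf_uminus: "gf sz (\<lambda>x. - w x) A = - gf sz w A"
  by (rule fps_ext) (simp add: gf_nth sum_negf)

lemma gf_Un_disjoint:
  assumes "\<And>n. finite {x \<in> A \<union> B. sz x = n}" and "A \<inter> B = {}"
  shows "gf sz w (A \<union> B) = gf sz w A + gf sz w B"
proof (rule fps_ext)
  fix n
  have "{x \<in> A \<union> B. sz x = n} = {x \<in> A. sz x = n} \<union> {x \<in> B. sz x = n}"
    by auto
  with assms(1)[of n] assms(2) show "gf sz w (A \<union> B) $ n = (gf sz w A + gf sz w B) $ n"
    unfolding fps_add_nth gf_nth by (subst sum.union_disjoint[symmetric]) auto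
qed

text \<open>Both recurrences below rest on bijections that raise the size by a constant
  \<open>k\<close>; \<open>k = 0\<close> covers mere changes of encoding.\<close>

lemma gf_reindex:
  assumes "bij_betw f A B"
    and sz: "\<And>x. x \<in> A \<Longrightarrow> sz' (f x) = k + sz x"
    and w: "\<And>x. x \<in> A \<Longrightarrow> w' (f x) = w x"
  shows "gf sz' w' B = fps_X ^ k * gf sz w A"
proof (rule fps_ext)
  fix n
  have inj: "inj_on f A" and B: "B = f ` A"
    using assms(1) by (auto simp: bij_betw_def)
  have "{y \<in> B. sz' y = n} = f ` {x \<in> A. k + sz x = n}"
    using sz B by force
  moreover have "inj_on f {x \<in> A. k + sz x = n}"
    by (rule inj_on_subset[OF inj]) auto
  ultimately have "gf sz' w' B $ n = (\<Sum>x\<in>{x \<in> A. k + sz x = n}. w x)"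
    by (simp add: gf_nth sum.reindex w)
  also have "\<dots> = (fps_X ^ k * gf sz w A) $ n"
  proof (cases "n < k")
    case True
    then have "{x \<in> A. k + sz x = n} = {}" by auto
    with True show ?thesis by (simp add: fps_X_power_mult_nth)
  next
    case False
    then have "{x \<in> A. k + sz x = n} = {x \<in> A. sz x = n - k}" by auto
    with False show ?thesis by (simp add: fps_X_power_mult_nth gf_nth)
  qed
  finally show "gf sz' w' B $ n = (fps_X ^ k * gf sz w A) $ n" .
qed

text \<open>Each coefficient receives only finitely many non-zero terms, which suffices for
  convergence of formal power series.\<close>

lemma gf_has_sum:
  assumes fin: "\<And>n. finite {x \<in> A. sz x = n}"
  shows "((\<lambda>x. fps_const (w x) * fps_X ^ sz x) has_sum gf sz w A) A"
proof (rule has_sum_fpsI)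
  fix n
  let ?F = "\<lambda>x. fps_const (w x) * fps_X ^ sz x"
  have eq: "?F x $ n = (if sz x = n then w x else 0)" for x
    by simp
  show "finite {x \<in> A. ?F x $ n \<noteq> 0}"
    by (rule finite_subset[OF _ fin[of n]]) (auto split: if_splits)
  show "gf sz w A $ n = (\<Sum>x | x \<in> A \<and> ?F x $ n \<noteq> 0. ?F x $ n)"
    unfolding gf_nth
    by (rule sum.mono_neutral_cong_right[OF fin[of n]]) (auto split: if_splits)
qed

section \<open>Partitions as multisets\<close>

definition parts_ge :: "nat \<Rightarrow> nat multiset set" where
  "parts_ge s = {M. \<forall>x\<in>#M. s \<le> x}"

text \<open>Multisets allow a part to be added or removed without restoring an order.\<close>

lemma bij_betw_mset_partitions: "bij_betw mset {p. is_partition p} (parts_ge 1)"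
proof (rule bij_betw_byWitness[where f' = "\<lambda>M. rev (sorted_list_of_multiset M)"])
  have "rev (sort p) = p" if "sorted_wrt (\<ge>) p" for p :: "nat list"
  proof -
    have "sort p = rev p"
      using that by (intro properties_for_sort) (simp_all add: sorted_wrt_rev)
    then show ?thesis by simp
  qed
  then show "\<forall>p\<in>{p. is_partition p}. rev (sorted_list_of_multiset (mset p)) = p"
    by (simp add: is_partition_def)
  show "(\<lambda>M. rev (sorted_list_of_multiset M)) ` parts_ge 1 \<subseteq> {p. is_partition p}"
    by (auto simp: is_partition_def parts_ge_def sorted_wrt_rev Suc_le_eq)
qed (auto simp: is_partition_def parts_ge_def Suc_le_eq)

lemma bij_betw_mset_nonempty_partitions:
  "bij_betw mset nonempty_partitions (parts_ge 1 - {{#}})"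
proof -
  have "nonempty_partitions = {p. is_partition p} - {[]}"
    by (auto simp: nonempty_partitions_def)
  moreover have "is_partition []"
    by (simp add: is_partition_def)
  ultimately show ?thesis
    using bij_betw_DiffI[OF bij_betw_mset_partitions, of "{[]}" "{{#}}"]
    by (simp add: bij_betw_def parts_ge_def)
qed

lemma finite_parts_ge_sum: "finite {M \<in> parts_ge 1. sum_mset M = n}"
proof (rule finite_subset)
  show "{M \<in> parts_ge 1. sum_mset M = n}
      \<subseteq> insert {#} (mset ` {p \<in> nonempty_partitions. sum_list p = n})"
  proof
    fix M assume M: "M \<in> {M \<in> parts_ge 1. sum_mset M = n}"
    show "M \<in> insert {#} (mset ` {p \<in> nonempty_partitions. sum_list p = n})"
    proof (cases "M = {#}")
      case False
      with M have "M \<in> mset ` nonempty_partitions"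
        using bij_betw_mset_nonempty_partitions by (auto simp: bij_betw_def)
      with M show ?thesis by (auto simp: sum_mset_sum_list)
    qed simp
  qed
qed (simp add: finite_partitions_of)

abbreviation "\<P> \<equiv> gf sum_mset (\<lambda>_. 1) (parts_ge 1)"

section \<open>Signed side: partitions with marked copies of the smallest part\<close>

text \<open>A partition with smallest part \<open>s\<close> occurring at least \<open>m\<close> times is encoded as \<open>(s, M)\<close>, where
  \<open>M\<close> is what remains after removing \<open>m\<close> copies of \<open>s\<close>. The set of codes does not depend on \<open>m\<close>,
  only the size of a code does.\<close>

definition marked :: "(nat \<times> nat multiset) set" where
  "marked = (SIGMA s:{1..}. parts_ge s)"

definition marked_size :: "nat \<Rightarrow> nat \<times> nat multiset \<Rightarrow> nat" where
  "marked_size m = (\<lambda>(s, M). m * s + sum_mset M)"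

definition marked_sign :: "nat \<times> nat multiset \<Rightarrow> int" where
  "marked_sign = (\<lambda>(s, M). (-1) ^ (s + 1))"

definition marked_gf :: "nat \<Rightarrow> int fps" where
  "marked_gf m = gf (marked_size m) marked_sign marked"

text \<open>Since m >= 1, the mark satisfies s <= m * s <= n; with m = 0 every
  \<open>(s, {#})\<close> would have size 0.\<close>

lemma finite_marked_size:
  assumes "1 \<le> m"
  shows "finite {x \<in> marked. marked_size m x = n}"
proof (rule finite_subset)
  show "{x \<in> marked. marked_size m x = n}
      \<subseteq> {..n} \<times> (\<Union>k\<in>{..n}. {M \<in> parts_ge 1. sum_mset M = k})"
  proof (rule subsetI, unfold split_paired_all)
    fix s M assume "(s, M) \<in> {x \<in> marked. marked_size m x = n}"
    then have M: "M \<in> parts_ge 1" and n: "m * s + sum_mset M = n"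
      by (auto simp: marked_def parts_ge_def marked_size_def)
    then have "s \<le> n"
      using mult_le_mono1[OF assms, of s] by linarith
    with M n show "(s, M) \<in> {..n} \<times> (\<Union>k\<in>{..n}. {M \<in> parts_ge 1. sum_mset M = k})"
      by simp
  qed
qed (use finite_parts_ge_sum in \<open>intro finite_cartesian_product finite_UN_I; blast\<close>)

lemma marked_gf_rec:
  assumes "1 \<le> m"
  shows "(1 + fps_X ^ m) * marked_gf m = fps_X ^ m * (\<P> + marked_gf (Suc m))"
proof -
  \<comment> \<open>The maps \<open>(s, M) \<mapsto> (s + 1, M)\<close> from the codes with \<open>s \<notin> M\<close> onto those with \<open>s \<ge> 2\<close>, and
    \<open>(s, M) \<mapsto> (s, M + {s})\<close> from all codes onto those with \<open>s \<in> M\<close>, are bijections; the first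
    one reverses the sign.\<close>
  let ?g = "gf (marked_size m) marked_sign"
  let ?one = "{x \<in> marked. fst x = 1}" and ?more = "{x \<in> marked. fst x \<noteq> 1}"
  let ?in = "{x \<in> marked. fst x \<in># snd x}" and ?out = "{x \<in> marked. fst x \<notin># snd x}"
  have fin: "finite {x \<in> marked. marked_size m x = n}" for n
    by (rule finite_marked_size[OF assms])
  have "?one \<union> ?more = marked" "?in \<union> ?out = marked"
    by auto
  then have split: "marked_gf m = ?g ?one + ?g ?more" "marked_gf m = ?g ?in + ?g ?out"
    using gf_Un_disjoint[of ?one ?more "marked_size m" marked_sign]
      gf_Un_disjoint[of ?in ?out "marked_size m" marked_sign] fin
    by (auto simp: marked_gf_def)
  \<comment> \<open>A mark s = 1 has sign +1 and leaves the remainder arbitrary.\<close>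
  have one: "?g ?one = fps_X ^ m * \<P>"
  proof (rule gf_reindex)
    show "bij_betw (Pair 1) (parts_ge 1) ?one"
      by (rule bij_betw_byWitness[where f' = snd]) (auto simp: marked_def)
  qed (simp_all add: marked_size_def marked_sign_def)
  have "?g ?more = fps_X ^ m * gf (marked_size m) (\<lambda>x. - marked_sign x) ?out"
  proof (rule gf_reindex)
    have "s \<noteq> x" if "x \<in># M" "\<forall>x\<in>#M. s \<le> x" "s \<notin># M" for s x :: nat and M
      using that by auto
    then show "bij_betw (\<lambda>(s, M). (Suc s, M)) ?out ?more"
      by (intro bij_betw_byWitness[where f' = "\<lambda>(s, M). (s - 1, M)"])
        (fastforce simp: marked_def parts_ge_def Suc_le_eq le_less)+
  qed (auto simp: marked_size_def marked_sign_def)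
  then have more: "?g ?more = - (fps_X ^ m * ?g ?out)"
    by (simp add: gf_uminus)
  \<comment> \<open>The added copy of s inside M is counted by \<open>marked_size (Suc m)\<close> as
    one more marked copy, so the total size stays the same.\<close>
  have "?g ?in = fps_X ^ 0 * gf (marked_size (Suc m)) marked_sign marked"
  proof (rule gf_reindex)
    show "bij_betw (\<lambda>(s, M). (s, add_mset s M)) marked ?in"
      by (rule bij_betw_byWitness[where f' = "\<lambda>(s, M). (s, M - {#s#})"])
        (auto simp: marked_def parts_ge_def dest: in_diffD)
  qed (auto simp: marked_size_def marked_sign_def)
  then have "?g ?in = marked_gf (Suc m)"
    by (simp add: marked_gf_def)
  with split(2) have out: "?g ?out = marked_gf m - marked_gf (Suc m)"
    by simp
  show ?thesis
    using split(1) unfolding one more out by (simp add: algebra_simps)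
qed

text \<open>For m = 1, splitting off one copy of the minimum encodes each non-empty partition
  exactly once.\<close>

lemma gf_smallest_part:
  "gf sum_list (\<lambda>p. (-1) ^ (smallest_part p + 1)) nonempty_partitions = marked_gf 1"
proof -
  have "gf sum_list (\<lambda>p. (-1) ^ (smallest_part p + 1)) nonempty_partitions
      = gf sum_mset (\<lambda>M. (-1) ^ (Min (set_mset M) + 1)) (parts_ge 1 - {{#}})"
    using gf_reindex[OF bij_betw_mset_nonempty_partitions, where k = 0 and sz' = sum_mset
        and w' = "\<lambda>M. (-1) ^ (Min (set_mset M) + 1)"]
    by (simp add: sum_mset_sum_list smallest_part_def)
  also have "\<dots> = fps_X ^ 0 * marked_gf 1"
    unfolding marked_gf_def
  proof (rule gf_reindex)
    have Min: "Min (insert s (set_mset M)) = s" if "(s, M) \<in> marked" for s M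
      using that by (intro Min_eqI) (auto simp: marked_def parts_ge_def)
    have Min_mem: "Min (set_mset M) \<in># M" if "M \<noteq> {#}" for M :: "nat multiset"
      using that by (intro Min_in) auto
    show "bij_betw (\<lambda>(s, M). add_mset s M) marked (parts_ge 1 - {{#}})"
    proof (rule bij_betw_byWitness[where f' = "\<lambda>M. (Min (set_mset M), M - {#Min (set_mset M)#})"])
      show "(\<lambda>M. (Min (set_mset M), M - {#Min (set_mset M)#})) ` (parts_ge 1 - {{#}}) \<subseteq> marked"
        using Min_mem by (fastforce simp: marked_def parts_ge_def simp del: Min_ge_iff dest: in_diffD)
    qed (auto simp: Min Min_mem, auto simp: marked_def parts_ge_def)
    show "(-1) ^ (Min (set_mset (case x of (s, M) \<Rightarrow> add_mset s M)) + 1) = marked_sign x"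
      if "x \<in> marked" for x
      using that by (cases x) (simp add: marked_sign_def Min)
  qed (auto simp: marked_size_def)
  finally show ?thesis by simp
qed

section \<open>Unsigned side: odd multiplicities of 1, ..., j\<close>

definition odd_upto :: "nat \<Rightarrow> nat multiset set" where
  "odd_upto j = {M \<in> parts_ge 1. \<forall>i\<in>{1..j}. odd (count M i)}"

abbreviation odd_upto_gf :: "nat \<Rightarrow> int fps" where
  "odd_upto_gf j \<equiv> gf sum_mset (\<lambda>_. 1) (odd_upto j)"

lemma odd_upto_gf_rec:
  "(1 + fps_X ^ Suc j) * odd_upto_gf (Suc j) = fps_X ^ Suc j * odd_upto_gf j"
proof -
  \<comment> \<open>Adding a part \<open>j + 1\<close> maps \<open>odd_upto j\<close> onto its members containing \<open>j + 1\<close>, and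
    \<open>odd_upto (j + 1)\<close> onto those containing it a positive even number of times.\<close>
  let ?even = "{M \<in> odd_upto j. even (count M (Suc j)) \<and> Suc j \<in># M}"
  let ?g = "gf sum_mset (\<lambda>_. 1 :: int)"
  have Suc: "odd_upto (Suc j) = {M \<in> odd_upto j. odd (count M (Suc j))}"
    by (auto simp: odd_upto_def atLeastAtMostSuc_conv)
  have "bij_betw (add_mset (Suc j)) (odd_upto j) {M \<in> odd_upto j. Suc j \<in># M}"
    by (rule bij_betw_byWitness[where f' = "\<lambda>M. M - {#Suc j#}"])
      (auto simp: odd_upto_def parts_ge_def dest: in_diffD)
  then have "fps_X ^ Suc j * odd_upto_gf j = ?g {M \<in> odd_upto j. Suc j \<in># M}"
    by (intro gf_reindex[symmetric]) auto
  \<comment> \<open>An odd count is positive, so containing \<open>Suc j\<close> is automatic in the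
    first piece.\<close>
  also have "{M \<in> odd_upto j. Suc j \<in># M} = odd_upto (Suc j) \<union> ?even"
    unfolding Suc by (auto intro: count_inI)
  also have "?g \<dots> = odd_upto_gf (Suc j) + ?g ?even"
  proof (rule gf_Un_disjoint)
    show "finite {M \<in> odd_upto (Suc j) \<union> ?even. sum_mset M = n}" for n
      by (rule finite_subset[OF _ finite_parts_ge_sum[of n]]) (auto simp: odd_upto_def)
  qed (auto simp: Suc)
  also have "?g ?even = fps_X ^ Suc j * odd_upto_gf (Suc j)"
  proof (rule gf_reindex)
    show "bij_betw (add_mset (Suc j)) (odd_upto (Suc j)) ?even"
      unfolding Suc
      by (rule bij_betw_byWitness[where f' = "\<lambda>M. M - {#Suc j#}"])
        (auto simp: odd_upto_def parts_ge_def count_eq_zero_iff dest: in_diffD)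
  qed auto
  finally show ?thesis
    by (simp add: algebra_simps)
qed

section \<open>Comparison of the two recurrences\<close>

lemma odd_upto_0: "odd_upto 0 = parts_ge 1"
  by (simp add: odd_upto_def)

text \<open>Induction on k: multiplying by 1 + q^(k+1) makes both recurrences applicable, and this
  factor, having constant coefficient 1, is cancelled at the end. The factor \<open>\<P>\<close> on
  the left avoids the quotient of \<open>odd_upto_gf k\<close> by \<open>\<P>\<close>.\<close>

lemma marked_gf_remainder:
  "\<P> * (marked_gf 1 - (\<Sum>j=1..k. odd_upto_gf j)) = odd_upto_gf k * marked_gf (Suc k)"
proof (induction k)
  case 0
  then show ?case by (simp add: odd_upto_0)
next
  case (Suc k)
  let ?q = "fps_X ^ Suc k :: int fps"
  have nz: "1 + ?q \<noteq> 0"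
  proof
    assume "1 + ?q = 0"
    then have "(1 + ?q) $ 0 = 0" by simp
    then show False by simp
  qed
  let ?S = "\<Sum>j=1..k. odd_upto_gf j"
  have "(1 + ?q) * (\<P> * (marked_gf 1 - (\<Sum>j=1..Suc k. odd_upto_gf j)))
      = (1 + ?q) * (\<P> * (marked_gf 1 - ?S)) - \<P> * ((1 + ?q) * odd_upto_gf (Suc k))"
    by (simp add: algebra_simps)
  also have "\<dots> = odd_upto_gf k * ((1 + ?q) * marked_gf (Suc k))
      - \<P> * ((1 + ?q) * odd_upto_gf (Suc k))"
    unfolding Suc.IH by (simp add: algebra_simps)
  \<comment> \<open>The two terms \<open>\<P> * ?q * odd_upto_gf k\<close> cancel.\<close>
  also have "\<dots> = (?q * odd_upto_gf k) * marked_gf (Suc (Suc k))"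
    unfolding odd_upto_gf_rec using marked_gf_rec[of "Suc k"] by (simp add: algebra_simps)
  also have "\<dots> = (1 + ?q) * (odd_upto_gf (Suc k) * marked_gf (Suc (Suc k)))"
    unfolding odd_upto_gf_rec[symmetric] by (simp add: algebra_simps)
  finally show ?case
    using nz by (simp only: mult_cancel_left) simp
qed

lemma marked_gf_nth: "marked_gf 1 $ n = (\<Sum>j=1..n. odd_upto_gf j $ n)"
proof -
  let ?E = "marked_gf 1 - (\<Sum>j=1..n. odd_upto_gf j)"
  have "?E $ n = 0"
  \<comment> \<open>The zero series has \<open>subdegree\<close> 0 by convention, so it is treated
    apart.\<close>
  proof (cases "?E = 0")
    case False
    have "{M \<in> parts_ge 1. sum_mset M = 0} = {{#}}"
      by (auto simp: parts_ge_def) (metis multiset_nonemptyE not_one_le_zero One_nat_def)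
    \<comment> \<open>The empty partition gives this 1; hence multiplication by \<open>\<P>\<close>
      preserves \<open>subdegree\<close>.\<close>
    then have P0: "\<P> $ 0 = 1"
      by (simp add: gf_nth)
    then have "\<P> \<noteq> 0" "subdegree \<P> = 0"
      by (metis fps_zero_nth zero_neq_one, metis subdegree_eq_0_iff zero_neq_one)
    with False have nz: "odd_upto_gf n * marked_gf (Suc n) \<noteq> 0"
      unfolding marked_gf_remainder[symmetric] by (simp only: mult_eq_0_iff simp_thms)
    have "subdegree (\<P> * ?E) = subdegree \<P> + subdegree ?E"
      using \<open>\<P> \<noteq> 0\<close> False by (rule subdegree_mult)
    with \<open>subdegree \<P> = 0\<close> have deg: "subdegree ?E = subdegree (odd_upto_gf n * marked_gf (Suc n))"
      unfolding marked_gf_remainder by (simp only: add_0)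
    \<comment> \<open>Every code has s >= 1, so its n + 1 marked copies already have size at least n
      + 1.\<close>
    have "subdegree (marked_gf (Suc n)) \<ge> Suc n"
    proof (rule subdegree_geI)
      show "marked_gf (Suc n) $ i = 0" if "i < Suc n" for i
      proof -
        have "marked_size (Suc n) x \<noteq> i" if "x \<in> marked" for x
          using that \<open>i < Suc n\<close> by (cases "fst x") (auto simp: marked_def marked_size_def)
        then have "{x \<in> marked. marked_size (Suc n) x = i} = {}"
          by blast
        then show ?thesis
          unfolding marked_gf_def gf_nth by (simp only: sum.empty)
      qed
    qed (use nz in auto)
    with deg nz have "n < subdegree ?E"
      by simp
    then show ?thesis
      by (rule nth_less_subdegree_zero)
  qed simp
  then show ?thesis
    by (simp add: fps_sum_nth)
qed

section \<open>Summing over the length of the odd run\<close>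

lemma le_odd_run_iff: "j \<le> odd_run p \<longleftrightarrow> (\<forall>i\<in>{1..j}. odd (freq p i))"
proof -
  have *: "(\<forall>i. 1 \<le> i \<and> i \<le> odd_run p \<longrightarrow> odd (freq p i)) \<and> even (freq p (odd_run p + 1))"
    unfolding odd_run_def by (rule theI'[OF odd_run_ex1])
  show ?thesis
  proof
    assume "\<forall>i\<in>{1..j}. odd (freq p i)"
    with * show "j \<le> odd_run p"
      by (metis Suc_eq_plus1 atLeastAtMost_iff le_add2 not_less_eq_eq)
  qed (use * in auto)
qed

text \<open>This lets the sum over j stop at n.\<close>

lemma odd_run_le_sum_list: "odd_run p \<le> sum_list p"
proof (cases "odd_run p = 0")
  case False
  then have "odd (freq p (odd_run p))"
    using le_odd_run_iff[of "odd_run p" p] by simp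
  then have "odd_run p \<in> set p"
    by (metis count_list_0_iff even_zero freq_def)
  then show ?thesis
    by (simp add: member_le_sum_list)
qed simp

text \<open>Write \<open>odd_run p\<close> as the number of j >= 1 with j \<le>
  \<open>odd_run p\<close> and exchange the sums; each j then counts the partitions in
  \<open>odd_upto j\<close>.\<close>

lemma gf_odd_run:
  "gf sum_list (\<lambda>p. int (odd_run p)) partitions_odd_ones $ n = (\<Sum>j=1..n. odd_upto_gf j $ n)"
proof -
  let ?L = "{p. is_partition p \<and> sum_list p = n}"
  have bij: "bij_betw mset {p \<in> ?L. j \<le> odd_run p} {M \<in> odd_upto j. sum_mset M = n}" for j
  proof -
    have "{M \<in> odd_upto j. sum_mset M = n} = mset ` {p \<in> ?L. j \<le> odd_run p}"
      unfolding odd_upto_def bij_betw_imp_surj_on[OF bij_betw_mset_partitions, symmetric]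
      by (auto simp: le_odd_run_iff freq_def sum_mset_sum_list count_mset)
    then show ?thesis
      using bij_betw_mset_partitions by (auto simp: bij_betw_def elim: inj_on_subset)
  qed
  have fin: "finite ?L"
  proof -
    have "?L \<subseteq> insert [] {p \<in> nonempty_partitions. sum_list p = n}"
      by (auto simp: nonempty_partitions_def)
    then show ?thesis
      using finite_partitions_of[of n] by (auto intro: finite_subset)
  qed
  \<comment> \<open>Partitions with an even number of ones, the empty one included, have
    \<open>odd_run\<close> 0 and can be added freely.\<close>
  have "gf sum_list (\<lambda>p. int (odd_run p)) partitions_odd_ones $ n = (\<Sum>p\<in>?L. int (odd_run p))"
    unfolding gf_nth
  proof (rule sum.mono_neutral_left[OF fin])
    have "odd_run p = 0" if "even (freq p 1)" for p
      using that le_odd_run_iff[of 1 p] by simp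
    then show "\<forall>p\<in>?L - {p \<in> partitions_odd_ones. sum_list p = n}. int (odd_run p) = 0"
      by (auto simp: partitions_odd_ones_def nonempty_partitions_def freq_def)
  qed (auto simp: partitions_odd_ones_def nonempty_partitions_def)
  also have "\<dots> = (\<Sum>p\<in>?L. \<Sum>j=1..n. if j \<le> odd_run p then 1 else 0)"
  proof (rule sum.cong[OF refl])
    fix p assume "p \<in> ?L"
    then have "{1..n} \<inter> {j. j \<le> odd_run p} = {1..odd_run p}"
      using odd_run_le_sum_list[of p] by auto
    then show "int (odd_run p) = (\<Sum>j=1..n. if j \<le> odd_run p then 1 else 0)"
      by (simp add: sum.If_cases)
  qed
  also have "\<dots> = (\<Sum>j=1..n. \<Sum>p\<in>?L. if j \<le> odd_run p then 1 else 0)"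
    by (rule sum.swap)
  also have "\<dots> = (\<Sum>j=1..n. int (card {p \<in> ?L. j \<le> odd_run p}))"
    using fin by (simp add: sum.If_cases Int_def)
  also have "\<dots> = (\<Sum>j=1..n. odd_upto_gf j $ n)"
    using bij_betw_same_card[OF bij] by (simp add: gf_nth)
  finally show ?thesis .
qed

theorem theorem3p1:
  shows
    "(\<forall>N::nat. 0 < N \<longrightarrow>
        (\<Sum>p\<in>{p \<in> nonempty_partitions. sum_list p = N}. (-1::int) ^ (smallest_part p + 1))
      = (\<Sum>p\<in>{p \<in> partitions_odd_ones. sum_list p = N}. int (odd_run p)))
   \<and> (\<lambda>p. fps_const ((-1::int) ^ (smallest_part p + 1)) * fps_X ^ sum_list p)
        summable_on nonempty_partitions
   \<and> (\<lambda>p. fps_const (int (odd_run p)) * fps_X ^ sum_list p) summable_on partitions_odd_ones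
   \<and> (\<Sum>\<^sub>\<infinity>p\<in>nonempty_partitions.
          fps_const ((-1::int) ^ (smallest_part p + 1)) * fps_X ^ sum_list p)
      = (\<Sum>\<^sub>\<infinity>p\<in>partitions_odd_ones. fps_const (int (odd_run p)) * fps_X ^ sum_list p)"
proof -
  let ?l = "gf sum_list (\<lambda>p. (-1) ^ (smallest_part p + 1)) nonempty_partitions"
  let ?r = "gf sum_list (\<lambda>p. int (odd_run p)) partitions_odd_ones"
  have eq: "?l = ?r"
    by (rule fps_ext) (simp only: gf_smallest_part marked_gf_nth gf_odd_run)
  have l: "((\<lambda>p. fps_const ((-1::int) ^ (smallest_part p + 1)) * fps_X ^ sum_list p)
      has_sum ?l) nonempty_partitions"
    by (rule gf_has_sum) (rule finite_partitions_of)
  have r: "((\<lambda>p. fps_const (int (odd_run p)) * fps_X ^ sum_list p) has_sum ?r) partitions_odd_ones"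
    by (rule gf_has_sum)
      (rule finite_subset[OF _ finite_partitions_of], auto simp: partitions_odd_ones_def)
  have "?l $ N = ?r $ N" for N
    by (simp only: eq)
  then show ?thesis
    unfolding gf_nth using l r eq by (metis (no_types, lifting) has_sum_imp_summable infsumI)
qed

end
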